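(* Let $n\ge 3$ and $v(n)=\ell(2n)-2$. Then: (i) the homological degree of $\Delta([n])$ is $v(n)$; (ii) the maximum of the homological degrees of the complexes $\Delta([n])_U$, as $U$ ranges over the non-empty subsets of $[n]$, is $v(n)$ (complexes all of whose reduced homology groups vanish do not contribute to this maximum).
   Context: Let $p_i$ denote the $i$-th prime and $\mathbb{PP}$ the set of prime powers $p^a$ ($p$ prime, $a\ge 1$). For a positive integer $n$ let $[n]=\{1,2,\dots,n\}$. $\Delta([n])$ is the simplicial complex whose vertex set is $[n]\cap\mathbb{PP}$ and in which a set $\sigma=\{q_1,\dots,q_s\}$ of prime powers is a simplex if and only if the $q_i$ are pairwise relatively prime and $q_1\cdots q_s\le n$ (the empty set is a simplex). For a subset $U$, $\Delta([n])_U=\{\sigma\in\Delta([n]) : \sigma\subseteq U\}$. The homological degree of a simplicial complex is the maximal $i$ such that its $i$-th reduced homology group with coefficients in $\mathbb{Z}$ is non-zero (the complex $\{\emptyset\}$ has non-zero reduced homology exactly in degree $-1$). $\ell(m)$ is the unique non-negative integer such that $\prod_{i=1}^{\ell(m)}p_i\le m<\prod_{i=1}^{\ell(m)+1}p_i$ (empty products equal $1$). Thus for $n\ge3$, $v(n)=\ell(2n)-2$ is the unique integer with $\prod_{j=2}^{v(n)+2}p_j\le n<\prod_{j=2}^{v(n)+3}p_j$. *)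

theory Defs
  imports
    "HOL-Algebra.Free_Abelian_Groups"
    "HOL-Number_Theory.Prime_Powers"
    "HOL-Library.Infinite_Set"
begin

(* An abstract simplicial complex is a set of simplices that contains the empty simplex.
   Degrees are integers; the empty simplex has dimension -1, which yields reduced
   (augmented) homology. *)

definition simplices_of_dim :: "int \<Rightarrow> 'a set set \<Rightarrow> 'a set set" where
  "simplices_of_dim i K = {\<sigma> \<in> K. finite \<sigma> \<and> int (card \<sigma>) = i + 1}"

definition simplicial_chain_group :: "int \<Rightarrow> 'a set set \<Rightarrow> ('a set \<Rightarrow>\<^sub>0 int) monoid" where
  "simplicial_chain_group i K = free_Abelian_group (simplices_of_dim i K)"

(* Each simplex is oriented by the order of the vertices, so the sign of the face omitting v
   is determined by the number of vertices preceding v. *)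
definition simplex_boundary :: "'a::linorder set \<Rightarrow> ('a set \<Rightarrow>\<^sub>0 int)" where
  "simplex_boundary \<sigma> =
     (\<Sum>v\<in>\<sigma>. frag_cmul ((-1) ^ card {w \<in> \<sigma>. w < v}) (frag_of (\<sigma> - {v})))"

definition simplicial_boundary :: "('a::linorder set \<Rightarrow>\<^sub>0 int) \<Rightarrow> ('a set \<Rightarrow>\<^sub>0 int)" where
  "simplicial_boundary = frag_extend simplex_boundary"

definition simplicial_cycles :: "int \<Rightarrow> 'a::linorder set set \<Rightarrow> ('a set \<Rightarrow>\<^sub>0 int) set" where
  "simplicial_cycles i K =
     kernel (simplicial_chain_group i K) (simplicial_chain_group (i - 1) K) simplicial_boundary"

definition simplicial_boundaries :: "int \<Rightarrow> 'a::linorder set set \<Rightarrow> ('a set \<Rightarrow>\<^sub>0 int) set" where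
  "simplicial_boundaries i K =
     simplicial_boundary ` carrier (simplicial_chain_group (i + 1) K)"

definition reduced_homology_group ::
    "int \<Rightarrow> 'a::linorder set set \<Rightarrow> ('a set \<Rightarrow>\<^sub>0 int) set monoid" where
  "reduced_homology_group i K =
     subgroup_generated (simplicial_chain_group i K) (simplicial_cycles i K)
       Mod simplicial_boundaries i K"

lemma simplicial_boundary_simplex_boundary:
  assumes fin: "finite \<sigma>"
  shows "simplicial_boundary (simplex_boundary \<sigma>) = 0"
proof -
  define s where "s = (\<lambda>(\<sigma>::'a set) v. (-1::int) ^ card {w \<in> \<sigma>. w < v})"
  define F where "F = (\<lambda>(v, w). frag_cmul (s \<sigma> v * s (\<sigma> - {v}) w) (frag_of (\<sigma> - {v} - {w})))"
  define D where "D = (SIGMA v:\<sigma>. \<sigma> - {v})"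
  have flip: "s \<sigma> v * s (\<sigma> - {v}) w = - (s \<sigma> w * s (\<sigma> - {w}) v)"
    if "v \<in> \<sigma>" "w \<in> \<sigma>" "v < w" for v w
  proof -
    have "{u \<in> \<sigma>. u < w} = insert v {u \<in> \<sigma> - {v}. u < w}"
      and 1: "{u \<in> \<sigma> - {w}. u < v} = {u \<in> \<sigma>. u < v}"
      using that by auto
    then have "card {u \<in> \<sigma>. u < w} = Suc (card {u \<in> \<sigma> - {v}. u < w})"
      using fin by simp
    then show ?thesis unfolding s_def 1 by simp
  qed
  have "F (v, w) = - F (w, v)" if "(v, w) \<in> D" for v w
  proof -
    have "s \<sigma> v * s (\<sigma> - {v}) w = - (s \<sigma> w * s (\<sigma> - {w}) v)"
      using that flip[of v w] flip[of w v] by (cases v w rule: linorder_cases) (auto simp: D_def)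
    then show ?thesis by (simp add: F_def Diff_insert2[symmetric] insert_commute)
  qed
  then have "sum F D = sum (\<lambda>x. - F (prod.swap x)) D"
    by (intro sum.cong) auto
  also have "\<dots> = sum (\<lambda>x. - F x) D"
    by (rule sum.reindex_bij_witness[where i=prod.swap and j=prod.swap]) (auto simp: D_def)
  finally have "sum F D = - sum F D" by (simp add: sum_negf)
  then have "Poly_Mapping.lookup (sum F D) x = - Poly_Mapping.lookup (sum F D) x" for x
    by (metis lookup_uminus)
  then have zero: "sum F D = 0" by (intro poly_mapping_eqI) simp
  have "simplicial_boundary (simplex_boundary \<sigma>) = (\<Sum>v\<in>\<sigma>. \<Sum>w\<in>\<sigma> - {v}. F (v, w))"
    unfolding simplicial_boundary_def
    by (subst simplex_boundary_def)
       (simp add: frag_extend_sum fin o_def frag_extend_cmul simplex_boundary_def frag_cmul_sum F_def s_def)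
  also have "\<dots> = sum F D"
    unfolding D_def using fin by (simp add: sum.Sigma)
  finally show ?thesis using zero by simp
qed

lemma group_reduced_homology_group:
  assumes K: "\<And>\<sigma> \<tau>. \<sigma> \<in> K \<Longrightarrow> \<tau> \<subseteq> \<sigma> \<Longrightarrow> \<tau> \<in> K"
  shows "group (reduced_homology_group i K)"
proof -
  have C: "comm_group (simplicial_chain_group j K)" for j
    by (simp add: simplicial_chain_group_def abelian_free_Abelian_group)
  have hom: "simplicial_boundary \<in> hom (simplicial_chain_group (j + 1) K) (simplicial_chain_group j K)" for j
  proof (rule homI)
    fix c assume c: "c \<in> carrier (simplicial_chain_group (j + 1) K)"
    have "\<sigma> - {v} \<in> simplices_of_dim j K" if "\<sigma> \<in> simplices_of_dim (j + 1) K" "v \<in> \<sigma>" for \<sigma> v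
    proof -
      have "card \<sigma> = Suc (card (\<sigma> - {v}))"
        using that by (intro card.remove) (auto simp: simplices_of_dim_def)
      then show ?thesis
        using that K[of \<sigma> "\<sigma> - {v}"] by (auto simp: simplices_of_dim_def)
    qed
    then have "Poly_Mapping.keys (simplex_boundary \<sigma>) \<subseteq> simplices_of_dim j K"
      if "\<sigma> \<in> simplices_of_dim (j + 1) K" for \<sigma>
      using that unfolding simplex_boundary_def
      by (intro order_trans[OF keys_sum]) (auto simp: keys_cmul_iff)
    moreover have "Poly_Mapping.keys c \<subseteq> simplices_of_dim (j + 1) K"
      using c by (simp add: simplicial_chain_group_def carrier_free_Abelian_group_iff)
    ultimately have "Poly_Mapping.keys (simplicial_boundary c) \<subseteq> simplices_of_dim j K"
      unfolding simplicial_boundary_def by (intro order_trans[OF keys_frag_extend]) blast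
    then show "simplicial_boundary c \<in> carrier (simplicial_chain_group j K)"
      by (simp add: simplicial_chain_group_def carrier_free_Abelian_group_iff)
  qed (simp add: simplicial_chain_group_def simplicial_boundary_def frag_extend_add)
  have gh: "group_hom (simplicial_chain_group (j + 1) K) (simplicial_chain_group j K) simplicial_boundary" for j
    using hom C by (simp add: group_hom_def group_hom_axioms_def comm_group.axioms)
  have bd: "subgroup (simplicial_boundaries i K) (simplicial_chain_group i K)"
    unfolding simplicial_boundaries_def
    using group_hom.img_is_subgroup[OF gh[of i]] by simp
  have "simplicial_boundary (simplicial_boundary c) = 0"
    if "c \<in> carrier (simplicial_chain_group (i + 1) K)" for c
  proof -
    have fin: "finite \<sigma>" if "\<sigma> \<in> Poly_Mapping.keys c" for \<sigma>
      using that \<open>c \<in> _\<close>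
      by (auto simp: simplicial_chain_group_def carrier_free_Abelian_group_iff simplices_of_dim_def)
    have "simplicial_boundary (simplicial_boundary c)
        = (\<Sum>\<sigma>\<in>Poly_Mapping.keys c. frag_cmul (Poly_Mapping.lookup c \<sigma>) (simplicial_boundary (simplex_boundary \<sigma>)))"
      unfolding simplicial_boundary_def frag_extend_def[of _ c]
      by (simp add: frag_extend_sum o_def frag_extend_cmul)
    then show ?thesis by (simp add: simplicial_boundary_simplex_boundary fin)
  qed
  moreover have "simplicial_boundaries i K \<subseteq> carrier (simplicial_chain_group i K)"
    by (rule subgroup.subset[OF bd])
  moreover have "\<one>\<^bsub>simplicial_chain_group (i - 1) K\<^esub> = 0"
    by (simp add: simplicial_chain_group_def)
  ultimately have sub: "simplicial_boundaries i K \<subseteq> simplicial_cycles i K"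
    unfolding simplicial_cycles_def kernel_def by (auto simp: simplicial_boundaries_def)
  interpret C: comm_group "simplicial_chain_group i K" by (rule C)
  have "simplicial_boundaries i K \<lhd> subgroup_generated (simplicial_chain_group i K) (simplicial_cycles i K)"
    using C.subgroup_of_subgroup_generated[OF sub bd] C.abelian_subgroup_generated[OF C]
    by (simp add: comm_group.normal_iff_subgroup)
  then show ?thesis
    unfolding reduced_homology_group_def by (rule normal.factorgroup_is_group)
qed

(* A relation rather than a function: a complex with vanishing reduced homology has no
   homological degree. *)
definition has_homological_degree :: "'a::linorder set set \<Rightarrow> int \<Rightarrow> bool" where
  "has_homological_degree K d \<longleftrightarrow>
     \<not> trivial_group (reduced_homology_group d K) \<and>
     (\<forall>i. \<not> trivial_group (reduced_homology_group i K) \<longrightarrow> i \<le> d)"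

definition induced_subcomplex :: "'a set set \<Rightarrow> 'a set \<Rightarrow> 'a set set" where
  "induced_subcomplex K U = {\<sigma> \<in> K. \<sigma> \<subseteq> U}"

definition coprime_complex :: "nat \<Rightarrow> nat set set" where
  "coprime_complex n =
     {\<sigma>. \<sigma> \<subseteq> {1..n} \<inter> {q. primepow q} \<and> pairwise coprime \<sigma> \<and> \<Prod>\<sigma> \<le> n}"

(* 1-based: nth_prime 1 = 2 *)
definition nth_prime :: "nat \<Rightarrow> nat" where
  "nth_prime i = enumerate {p. prime p} (i - 1)"

definition ell :: "nat \<Rightarrow> nat" where
  "ell m = (THE k. (\<Prod>i=1..k. nth_prime i) \<le> m \<and> m < (\<Prod>i=1..k+1. nth_prime i))"

lemma nth_prime_prime: "prime (nth_prime i)"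
  unfolding nth_prime_def using enumerate_in_set[OF primes_infinite] by blast

lemma ell_ex1:
  assumes "m > 0"
  shows "\<exists>!k. (\<Prod>i=1..k. nth_prime i) \<le> m \<and> m < (\<Prod>i=1..k+1. nth_prime i)"
proof -
  define P where "P k = (\<Prod>i=1..k. nth_prime i)" for k
  have step: "P k < P (Suc k)" for k
    using prime_gt_1_nat[OF nth_prime_prime] prime_gt_0_nat[OF nth_prime_prime]
    by (simp add: P_def prod_pos)
  have sm: "strict_mono P"
    using step by (simp add: strict_mono_Suc_iff)
  have P0: "P 0 = 1" by (simp add: P_def)
  have bound: "k \<le> m" if "P k \<le> m" for k
    using strict_mono_imp_increasing[OF sm, of k] that by linarith
  define k where "k = (GREATEST k. P k \<le> m)"
  have "P k \<le> m"
    unfolding k_def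
    by (rule GreatestI_nat[where P="\<lambda>k. P k \<le> m" and k=0 and b=m]) (use assms P0 bound in simp_all)
  moreover have "m < P (k + 1)"
  proof (rule ccontr)
    assume "\<not> m < P (k + 1)"
    then have "P (k + 1) \<le> m" by simp
    then have "k + 1 \<le> k"
      unfolding k_def
      by (rule Greatest_le_nat[where P="\<lambda>k. P k \<le> m" and b=m]) (use bound in simp)
    then show False by simp
  qed
  moreover have "j = k" if "P j \<le> m" "m < P (j + 1)" "P k \<le> m" "m < P (k + 1)" for j
  proof -
    have "j < k + 1" "k < j + 1"
      using le_less_trans[OF that(1,4)] le_less_trans[OF that(3,2)] strict_mono_less[OF sm] by auto
    then show ?thesis by simp
  qed
  ultimately show ?thesis unfolding P_def by blast
qed

definition v_index :: "nat \<Rightarrow> int" where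
  "v_index n = int (ell (2 * n)) - 2"

end

theory Submission
  imports Defs
begin

text \<open>Write \<open>p\<^sub>1 < p\<^sub>2 < \<dots>\<close> for the primes and \<open>k = \<ell>(2n)\<close>, so that \<open>v(n) = k - 2\<close> and
  \<open>p\<^sub>2 \<cdots> p\<^sub>k \<le> n < p\<^sub>2 \<cdots> p\<^sub>k\<^sub>+\<^sub>1\<close>.

  Upper bound, for all induced subcomplexes at once. Let \<open>c\<close> be a non-zero cycle whose
  simplices have \<open>M \<ge> k\<close> vertices. Its support is a family of \<open>M\<close>-sets without free faces: any
  vertex of a member can be exchanged for another vertex within the family
  (\<open>cycle_support_exchange\<close>). Treating \<open>p\<^sub>1, p\<^sub>2, \<dots>\<close> in turn and exchanging \<open>p\<^sub>j\<close> whenever it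
  is itself a vertex, one reaches a simplex in which, for some \<open>i\<close>, the primes
  \<open>p\<^sub>1, \<dots>, p\<^sub>i\<^sub>-\<^sub>1\<close> occur only through powers with exponent at least 2 and \<open>p\<^sub>i\<close> does not
  occur (\<open>exchange_reaches_gap\<close>). Its product is at least
  \<open>(p\<^sub>1 \<cdots> p\<^sub>i\<^sub>-\<^sub>1)\<^sup>2 p\<^sub>i\<^sub>+\<^sub>1 \<cdots> p\<^sub>M\<^sub>+\<^sub>1\<close>, and Euclid's bound \<open>p\<^sub>i \<le> p\<^sub>1 \<cdots> p\<^sub>i\<^sub>-\<^sub>1 + 1\<close> shows that
  this is at least \<open>p\<^sub>2 \<cdots> p\<^sub>M\<^sub>+\<^sub>1 > n\<close> (\<open>exchange_family_large_prod\<close>). This contradicts that the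
  simplex belongs to the complex, so there are no non-zero cycles above degree \<open>v(n)\<close>.

  Lower bound. The boundary of the simplex \<open>{2\<^sup>a, p\<^sub>2, \<dots>, p\<^sub>k}\<close>, with \<open>2\<^sup>a\<close> as large as
  possible subject to \<open>2\<^sup>a p\<^sub>3 \<cdots> p\<^sub>k \<le> n\<close>, is a cycle of degree \<open>v(n)\<close> in the complex. Its face
  omitting \<open>p\<^sub>2 = 3\<close> is a maximal simplex, hence has coefficient 0 in every boundary, but it
  has coefficient \<open>\<plusminus> 1\<close> in this cycle (\<open>nontrivial_homology_at\<close>).\<close>

section \<open>Reduced homology seen through the supports of cycles\<close>

lemma lookup_simplex_boundary:
  assumes "finite \<rho>" "v \<in> \<rho>"
  shows "Poly_Mapping.lookup (simplex_boundary \<rho>) (\<rho> - {v}) = (-1) ^ card {w \<in> \<rho>. w < v}"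
proof -
  have eq: "\<rho> - {w} = \<rho> - {v} \<longleftrightarrow> w = v" if "w \<in> \<rho>" for w
    using that assms(2) by blast
  have "Poly_Mapping.lookup (simplex_boundary \<rho>) (\<rho> - {v}) =
      (\<Sum>w\<in>\<rho>. if w = v then (-1) ^ card {u \<in> \<rho>. u < w} else 0)"
    unfolding simplex_boundary_def lookup_sum
    by (intro sum.cong) (auto simp: lookup_frag_of eq)
  then show ?thesis using assms by simp
qed

lemma keys_simplex_boundary:
  assumes "finite \<rho>"
  shows "Poly_Mapping.keys (simplex_boundary \<rho>) = (\<lambda>v. \<rho> - {v}) ` \<rho>"
proof
  show "Poly_Mapping.keys (simplex_boundary \<rho>) \<subseteq> (\<lambda>v. \<rho> - {v}) ` \<rho>"
    unfolding simplex_boundary_def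
    by (intro order_trans[OF keys_sum]) (auto simp: keys_cmul_iff)
  show "(\<lambda>v. \<rho> - {v}) ` \<rho> \<subseteq> Poly_Mapping.keys (simplex_boundary \<rho>)"
    using lookup_simplex_boundary[OF assms] by (auto simp: in_keys_iff)
qed

lemma lookup_simplicial_boundary:
  "Poly_Mapping.lookup (simplicial_boundary c) \<tau> =
     (\<Sum>\<rho>\<in>Poly_Mapping.keys c. Poly_Mapping.lookup c \<rho> * Poly_Mapping.lookup (simplex_boundary \<rho>) \<tau>)"
  by (simp add: simplicial_boundary_def frag_extend_def lookup_sum)

text \<open>A cycle has no free faces: all boundary coefficients of simplices are \<open>\<plusminus> 1\<close>, so a face
  of exactly one simplex of the support would survive in the boundary.\<close>

lemma cycle_support_exchange:
  assumes fin: "\<And>\<rho>. \<rho> \<in> Poly_Mapping.keys c \<Longrightarrow> finite \<rho>"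
    and cycle: "simplicial_boundary c = 0"
    and \<sigma>: "\<sigma> \<in> Poly_Mapping.keys c" "v \<in> \<sigma>"
  shows "\<exists>w. w \<noteq> v \<and> insert w (\<sigma> - {v}) \<in> Poly_Mapping.keys c"
proof (rule ccontr)
  assume no_exchange: "\<not> ?thesis"
  let ?term = "\<lambda>\<rho>. Poly_Mapping.lookup c \<rho> * Poly_Mapping.lookup (simplex_boundary \<rho>) (\<sigma> - {v})"
  have "?term \<rho> = 0" if \<rho>: "\<rho> \<in> Poly_Mapping.keys c" "\<rho> \<noteq> \<sigma>" for \<rho>
  proof (rule ccontr)
    assume "?term \<rho> \<noteq> 0"
    then have "\<sigma> - {v} \<in> (\<lambda>w. \<rho> - {w}) ` \<rho>"
      using fin[OF \<rho>(1)] by (auto simp: in_keys_iff simp flip: keys_simplex_boundary)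
    then obtain w where "w \<in> \<rho>" "\<rho> = insert w (\<sigma> - {v})" by auto
    with no_exchange \<rho> \<sigma>(2) show False by (metis insert_Diff)
  qed
  then have "(\<Sum>\<rho>\<in>Poly_Mapping.keys c - {\<sigma>}. ?term \<rho>) = 0"
    by (intro sum.neutral) auto
  then have "(\<Sum>\<rho>\<in>Poly_Mapping.keys c. ?term \<rho>) = ?term \<sigma>"
    using \<sigma>(1) sum.remove[of "Poly_Mapping.keys c" \<sigma> ?term] by simp
  moreover have "?term \<sigma> \<noteq> 0"
    using \<sigma> fin lookup_simplex_boundary[of \<sigma> v] by (simp add: in_keys_iff)
  ultimately show False
    using lookup_simplicial_boundary[of c "\<sigma> - {v}"] cycle by simp
qed

lemma simplicial_cycles_iff:
  "c \<in> simplicial_cycles i K \<longleftrightarrow>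
     Poly_Mapping.keys c \<subseteq> simplices_of_dim i K \<and> simplicial_boundary c = 0"
  by (auto simp: simplicial_cycles_def kernel_def simplicial_chain_group_def)

lemma trivial_homology_if_no_cycles:
  assumes K: "\<And>\<sigma> \<tau>. \<sigma> \<in> K \<Longrightarrow> \<tau> \<subseteq> \<sigma> \<Longrightarrow> \<tau> \<in> K"
    and "\<And>c. c \<in> simplicial_cycles i K \<Longrightarrow> c = 0"
  shows "trivial_group (reduced_homology_group i K)"
proof -
  interpret H: group "reduced_homology_group i K"
    by (rule group_reduced_homology_group) (rule K)
  let ?C = "simplicial_chain_group i K"
  interpret C: group ?C by (simp add: simplicial_chain_group_def)
  have "carrier (subgroup_generated ?C (simplicial_cycles i K)) \<subseteq> {\<one>\<^bsub>?C\<^esub>}"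
    using C.trivial_group_subgroup_generated[of "simplicial_cycles i K"] assms(2)
    by (auto simp: trivial_group_def simplicial_chain_group_def)
  then have "carrier (reduced_homology_group i K) \<subseteq>
      {simplicial_boundaries i K #>\<^bsub>subgroup_generated ?C (simplicial_cycles i K)\<^esub> \<one>\<^bsub>?C\<^esub>}"
    by (auto simp: reduced_homology_group_def FactGroup_def RCOSETS_def)
  then show ?thesis using H.trivial_group_alt by blast
qed

lemma nontrivial_homology_if_cycle_not_boundary:
  assumes "z \<in> simplicial_cycles i K" "z \<notin> simplicial_boundaries i K"
  shows "\<not> trivial_group (reduced_homology_group i K)"
proof
  assume triv: "trivial_group (reduced_homology_group i K)"
  let ?C = "simplicial_chain_group i K" and ?B = "simplicial_boundaries i K"
  let ?Z = "subgroup_generated ?C (simplicial_cycles i K)"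
  have "z \<in> carrier ?Z"
    using assms(1) unfolding carrier_subgroup_generated
    by (intro generate.incl) (simp add: simplicial_cycles_def kernel_def)
  then have "?B #>\<^bsub>?Z\<^esub> z \<in> carrier (reduced_homology_group i K)"
    by (auto simp: reduced_homology_group_def FactGroup_def RCOSETS_def)
  then have "?B #>\<^bsub>?Z\<^esub> z = ?B"
    using triv by (simp add: trivial_group_def reduced_homology_group_def FactGroup_def)
  moreover have "0 \<in> ?B"
    unfolding simplicial_boundaries_def
    by (rule image_eqI[of _ _ 0]) (auto simp: simplicial_boundary_def simplicial_chain_group_def)
  ultimately have "z \<in> ?B"
    by (auto simp: r_coset_def simplicial_chain_group_def)
  with assms(2) show False by simp
qed

text \<open>The boundary of a chain of \<open>K\<close> vanishes on a simplex that has no cofaces in \<open>K\<close>, whereas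
  the boundary of \<open>T\<close> has coefficient \<open>\<plusminus> 1\<close> there. Maximality of the face forces \<open>T \<notin> K\<close>: the
  boundary of \<open>T\<close> is a sphere in \<open>K\<close> that is not filled.\<close>

lemma nontrivial_homology_if_maximal_face:
  assumes T: "finite T" "int (card T) = i + 2"
    and faces: "\<And>v. v \<in> T \<Longrightarrow> T - {v} \<in> K"
    and v: "v \<in> T"
    and maximal: "\<And>w. w \<notin> T - {v} \<Longrightarrow> insert w (T - {v}) \<notin> K"
  shows "\<not> trivial_group (reduced_homology_group i K)"
proof (rule nontrivial_homology_if_cycle_not_boundary)
  let ?z = "simplex_boundary T"
  have "card (T - {u}) + 1 = card T" if "u \<in> T" for u
    using T(1) that card.remove[OF T(1) that] by simp
  then have "int (card (T - {u})) = i + 1" if "u \<in> T" for u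
    using T(2) that by fastforce
  then show "?z \<in> simplicial_cycles i K"
    using T(1) faces simplicial_boundary_simplex_boundary[OF T(1)]
    by (auto simp: simplicial_cycles_iff keys_simplex_boundary simplices_of_dim_def)
  show "?z \<notin> simplicial_boundaries i K"
  proof
    assume "?z \<in> simplicial_boundaries i K"
    then obtain c where c: "Poly_Mapping.keys c \<subseteq> simplices_of_dim (i + 1) K"
        "?z = simplicial_boundary c"
      by (auto simp: simplicial_boundaries_def simplicial_chain_group_def)
    have "Poly_Mapping.lookup (simplex_boundary \<rho>) (T - {v}) = 0" if "\<rho> \<in> Poly_Mapping.keys c" for \<rho>
    proof (rule ccontr)
      assume nz: "\<not> ?thesis"
      have \<rho>: "\<rho> \<in> K" "finite \<rho>" using that c(1) by (auto simp: simplices_of_dim_def)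
      from nz have "T - {v} \<in> (\<lambda>w. \<rho> - {w}) ` \<rho>"
        using \<rho>(2) by (simp add: in_keys_iff flip: keys_simplex_boundary)
      then obtain w where "w \<in> \<rho>" "T - {v} = \<rho> - {w}" by auto
      then have "w \<notin> T - {v}" "insert w (T - {v}) = \<rho>" by auto
      with maximal \<rho>(1) show False by metis
    qed
    then have "Poly_Mapping.lookup ?z (T - {v}) = 0"
      by (simp add: c(2) lookup_simplicial_boundary)
    with lookup_simplex_boundary[OF T(1) v] show False by simp
  qed
qed

section \<open>Products of consecutive primes\<close>

lemma nth_prime_less: "i \<ge> 1 \<Longrightarrow> i < j \<Longrightarrow> nth_prime i < nth_prime j"
  unfolding nth_prime_def by (intro enumerate_mono primes_infinite) auto

lemma nth_prime_mono: "i \<ge> 1 \<Longrightarrow> i \<le> j \<Longrightarrow> nth_prime i \<le> nth_prime j"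
  using nth_prime_less[of i j] by (cases "i = j") auto

lemma nth_prime_inj: "i \<ge> 1 \<Longrightarrow> j \<ge> 1 \<Longrightarrow> nth_prime i = nth_prime j \<Longrightarrow> i = j"
  using nth_prime_less[of i j] nth_prime_less[of j i] by (cases i j rule: linorder_cases) auto

lemma nth_prime_power_inj:
  assumes "l \<ge> 1" "m \<ge> 1" "a > 0" "nth_prime l ^ a = nth_prime m ^ b"
  shows "l = m"
proof -
  have "nth_prime l dvd nth_prime m ^ b"
    unfolding assms(4)[symmetric] using assms(3) by simp
  then have "nth_prime l = nth_prime m"
    using nth_prime_prime by (meson prime_dvd_power primes_dvd_imp_eq)
  then show ?thesis using nth_prime_inj assms(1,2) by blast
qed

lemma prime_is_nth_prime:
  assumes "prime r"
  obtains i where "i \<ge> 1" "r = nth_prime i"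
proof -
  obtain m where "enumerate {p. prime p} m = r"
    using enumerate_Ex[OF primes_infinite, of r] assms by auto
  then show ?thesis using that[of "Suc m"] by (simp add: nth_prime_def)
qed

lemma nth_prime_1: "nth_prime 1 = 2"
proof -
  obtain i where i: "i \<ge> 1" "2 = nth_prime i"
    using prime_is_nth_prime[of 2] by (auto simp: two_is_prime_nat)
  then show ?thesis
    using nth_prime_mono[of 1 i] prime_ge_2_nat[OF nth_prime_prime, of 1] by simp
qed

lemma nth_prime_2: "nth_prime 2 = 3"
proof -
  obtain i where i: "i \<ge> 1" "3 = nth_prime i"
    using prime_is_nth_prime[of 3] by auto
  then have "i \<noteq> 1" using nth_prime_1 by auto
  then show ?thesis
    using i nth_prime_mono[of 2 i] nth_prime_less[of 1 2] nth_prime_1 by simp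
qed

lemma nth_prime_pos: "nth_prime i > 0"
  using nth_prime_prime by (rule prime_gt_0_nat)

text \<open>Euclid's argument: a prime factor of the product plus one differs from the first
  \<open>i - 1\<close> primes, so it is at least the \<open>i\<close>-th.\<close>

lemma nth_prime_le_Suc_prod:
  assumes "i \<ge> 1"
  shows "nth_prime i \<le> (\<Prod>l=1..<i. nth_prime l) + 1"
proof -
  let ?X = "\<Prod>l=1..<i. nth_prime l"
  have "?X > 0" by (simp add: prod_pos nth_prime_pos)
  then obtain r where r: "prime r" "r dvd ?X + 1"
    using prime_factor_nat[of "?X + 1"] by auto
  obtain j where j: "j \<ge> 1" "r = nth_prime j" using prime_is_nth_prime[OF r(1)] .
  have "j \<ge> i"
  proof (rule ccontr)
    assume "\<not> i \<le> j"
    then have "r dvd ?X" using j by (auto intro: dvd_prodI)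
    then have "r dvd 1" using r(2) by (metis dvd_add_right_iff)
    then show False using r(1) by simp
  qed
  then show ?thesis
    using nth_prime_mono[OF assms, of j] j(2) dvd_imp_le[OF r(2)] by simp
qed

text \<open>This is the numerical reason for the upper bound on the degree. With \<open>X\<close> the product of
  the primes before the \<open>i\<close>-th one and \<open>i \<ge> 2\<close>, the claim reads \<open>(X / 2) p\<^sub>i \<le> X\<^sup>2\<close>, that is
  \<open>p\<^sub>i \<le> 2 X\<close>, which follows from Euclid's bound \<open>p\<^sub>i \<le> X + 1\<close>.\<close>

lemma prod_primes_le_square:
  assumes "i \<ge> 1"
  shows "(\<Prod>l=2..i. nth_prime l) \<le> (\<Prod>l=1..<i. (nth_prime l)\<^sup>2)"
proof (cases "i = 1")
  case False
  let ?X = "\<Prod>l=1..<i. nth_prime l"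
  have X: "?X \<ge> 1" by (simp add: Suc_le_eq prod_pos nth_prime_pos)
  have i: "i \<ge> 2" using False assms by simp
  have "?X = 2 * (\<Prod>l=2..<i. nth_prime l)"
    using i nth_prime_1 by (simp add: prod.atLeast_Suc_lessThan numeral_2_eq_2)
  moreover have "(\<Prod>l=2..i. nth_prime l) = (\<Prod>l=2..<i. nth_prime l) * nth_prime i"
    using i by (simp add: prod.last_plus mult.commute)
  ultimately have "2 * (\<Prod>l=2..i. nth_prime l) = ?X * nth_prime i" by simp
  also have "\<dots> \<le> ?X * (?X + 1)"
    using nth_prime_le_Suc_prod[OF assms] by (rule mult_left_mono) simp
  also have "\<dots> \<le> ?X * (2 * ?X)"
    using X by (intro mult_left_mono) auto
  finally have "(\<Prod>l=2..i. nth_prime l) \<le> ?X\<^sup>2" by (simp add: power2_eq_square)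
  then show ?thesis by (simp add: prod_power_distrib)
qed simp

lemma prod_consecutive_primes_le:
  assumes "finite J" "J \<subseteq> {i<..}"
  shows "(\<Prod>l=i+1..i + card J. nth_prime l) \<le> (\<Prod>l\<in>J. nth_prime l)"
  using assms
proof (induction rule: finite_linorder_max_induct)
  case (insert b A)
  have "A \<subseteq> {i<..<b}" using insert by auto
  then have "card A \<le> b - Suc i" using card_mono[of "{i<..<b}" A] by simp
  then have b: "i + card A + 1 \<le> b" using insert.prems by auto
  have "b \<notin> A" using insert.hyps by auto
  then have card: "card (insert b A) = Suc (card A)" using insert.hyps by simp
  have "(\<Prod>l=i+1..i + card (insert b A). nth_prime l) =
      (\<Prod>l=i+1..i + card A. nth_prime l) * nth_prime (i + card A + 1)"
    by (simp add: card)
  also have "\<dots> \<le> (\<Prod>l\<in>A. nth_prime l) * nth_prime b"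
    using insert b by (intro mult_mono nth_prime_mono) auto
  also have "\<dots> = (\<Prod>l\<in>insert b A. nth_prime l)"
    using \<open>b \<notin> A\<close> insert.hyps by simp
  finally show ?case .
qed simp

text \<open>Prime factors chosen from pairwise coprime numbers are distinct.\<close>

lemma coprime_prod_ge_consecutive_primes:
  assumes B: "finite B" "pairwise coprime B" "\<And>b. b \<in> B \<Longrightarrow> b > 1"
    and large: "\<And>b l. b \<in> B \<Longrightarrow> 1 \<le> l \<Longrightarrow> l \<le> i \<Longrightarrow> \<not> nth_prime l dvd b"
  shows "(\<Prod>l=i+1..i + card B. nth_prime l) \<le> \<Prod>B"
proof -
  have "\<exists>l. l \<ge> 1 \<and> nth_prime l dvd b" if "b \<in> B" for b
    using prime_factor_nat[of b] B(3)[OF that] prime_is_nth_prime by (metis nat_less_le)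
  then obtain g where g: "\<And>b. b \<in> B \<Longrightarrow> g b \<ge> 1 \<and> nth_prime (g b) dvd b" by metis
  have "inj_on g B"
  proof (rule inj_onI, rule ccontr)
    fix a b assume ab: "a \<in> B" "b \<in> B" "g a = g b" "a \<noteq> b"
    then have "coprime a b" using B(2) by (auto simp: pairwise_def)
    moreover have "nth_prime (g a) dvd a" "nth_prime (g a) dvd b"
      using g[OF ab(1)] g[OF ab(2)] ab(3) by simp_all
    ultimately have "is_unit (nth_prime (g a))" by (rule coprime_common_divisor)
    then show False using nth_prime_prime not_prime_unit by blast
  qed
  moreover have "g ` B \<subseteq> {i<..}" using g large by force
  ultimately have "(\<Prod>l=i+1..i + card B. nth_prime l) \<le> (\<Prod>b\<in>B. nth_prime (g b))"
    using prod_consecutive_primes_le[of "g ` B" i] B(1)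
    by (simp add: card_image prod.reindex)
  also have "\<dots> \<le> \<Prod>B"
  proof (intro prod_mono conjI)
    fix b assume "b \<in> B"
    then show "nth_prime (g b) \<le> b" using g B(3)[of b] by (intro dvd_imp_le) auto
  qed simp
  finally show ?thesis .
qed

section \<open>Coprime sets of prime powers with exchange\<close>

lemma primepow_divisible_by_prime:
  fixes q p :: nat
  assumes "primepow q" "prime p" "p dvd q"
  obtains a where "a \<ge> 1" "q = p ^ a"
proof -
  obtain r b where rb: "prime r" "b > 0" "q = r ^ b"
    using assms(1) unfolding primepow_def by blast
  then have "p = r" using assms(2,3) by (meson prime_dvd_power primes_dvd_imp_eq)
  then show ?thesis using that[of b] rb by simp
qed

text \<open>If the first \<open>i - 1\<close> primes enter a coprime set only through proper powers and the \<open>i\<close>-th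
  prime does not enter at all, then the other members supply at least the next primes after
  the \<open>i\<close>-th, and the squares make up for the missing one.\<close>

lemma prod_ge_if_proper_powers_then_gap:
  assumes \<sigma>: "finite \<sigma>" "pairwise coprime \<sigma>" "\<And>q. q \<in> \<sigma> \<Longrightarrow> primepow q"
    and i: "i \<ge> 1"
    and powers: "\<And>l. 1 \<le> l \<Longrightarrow> l < i \<Longrightarrow> \<exists>a\<ge>2. nth_prime l ^ a \<in> \<sigma>"
    and gap: "\<And>q. q \<in> \<sigma> \<Longrightarrow> \<not> nth_prime i dvd q"
  shows "(\<Prod>l=2..card \<sigma> + 1. nth_prime l) \<le> \<Prod>\<sigma>"
proof -
  obtain e where e: "\<And>l. 1 \<le> l \<Longrightarrow> l < i \<Longrightarrow> e l \<ge> 2 \<and> nth_prime l ^ e l \<in> \<sigma>"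
    using powers by metis
  define f where "f l = nth_prime l ^ e l" for l
  define A where "A = f ` {1..<i}"
  have A: "A \<subseteq> \<sigma>" using e by (auto simp: A_def f_def)
  have inj: "inj_on f {1..<i}"
  proof (rule inj_onI)
    fix l m assume lm: "l \<in> {1..<i}" "m \<in> {1..<i}" "f l = f m"
    then show "l = m"
      using e[of l] by (intro nth_prime_power_inj[OF _ _ _ lm(3)[unfolded f_def]]) auto
  qed
  have card_A: "card A = i - 1" unfolding A_def using card_image[OF inj] by simp
  have "(\<Prod>l=1..<i. (nth_prime l)\<^sup>2) \<le> (\<Prod>l=1..<i. f l)"
    using e nth_prime_pos unfolding f_def
    by (intro prod_mono conjI power_increasing) (auto simp: Suc_le_eq)
  then have prod_A: "(\<Prod>l=2..i. nth_prime l) \<le> \<Prod>A"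
    using prod_primes_le_square[OF i] prod.reindex[OF inj, of "\<lambda>q. q"] by (simp add: A_def o_def)
  have "\<not> nth_prime l dvd b" if b: "b \<in> \<sigma> - A" and l: "1 \<le> l" "l \<le> i" for b l
  proof (cases "l = i")
    case False
    then have l': "l < i" using l by simp
    then have "f l \<in> A" using l by (auto simp: A_def)
    then have "coprime (f l) b" using A b \<sigma>(2) by (auto simp: pairwise_def)
    then show ?thesis
      using e[OF l(1) l'] nth_prime_prime[of l] unfolding f_def
      by (metis coprime_common_divisor dvd_power not_prime_unit pos2 less_le_trans)
  qed (use b gap in auto)
  then have prod_B: "(\<Prod>l=i+1..i + card (\<sigma> - A). nth_prime l) \<le> \<Prod>(\<sigma> - A)"
  proof (intro coprime_prod_ge_consecutive_primes)
    show "pairwise coprime (\<sigma> - A)" using \<sigma>(2) by (rule pairwise_subset) auto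
    show "b > 1" if "b \<in> \<sigma> - A" for b
      using that \<sigma>(3)[of b] primepow_gt_Suc_0[of b] by simp
  qed (use \<sigma>(1) in auto)
  have "card \<sigma> + 1 = i + card (\<sigma> - A)"
    using A card_A i card_mono[OF \<sigma>(1) A] card_Diff_subset[of A \<sigma>] \<sigma>(1) by (simp add: A_def)
  then have "(\<Prod>l=2..card \<sigma> + 1. nth_prime l) =
      (\<Prod>l=2..i. nth_prime l) * (\<Prod>l=i+1..i + card (\<sigma> - A). nth_prime l)"
    using i prod.ub_add_nat[of 2 i nth_prime "card (\<sigma> - A)"] by simp
  also have "\<dots> \<le> \<Prod>A * \<Prod>(\<sigma> - A)" using prod_A prod_B by (rule mult_mono) auto
  also have "\<dots> = \<Prod>\<sigma>" by (metis prod.subset_diff[OF A \<sigma>(1)] mult.commute)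
  finally show ?thesis .
qed

text \<open>The primes are treated in increasing order. As long as each earlier prime occurs through
  a proper power, the next prime \<open>p\<close> either does not occur, or occurs through a proper power, or
  is itself a member. In the last case exchanging \<open>p\<close> for another vertex leads to one of the
  first two cases and leaves the powers of the earlier primes in place.\<close>

lemma exchange_reaches_gap:
  assumes S: "S \<noteq> {}"
    and coprime: "\<And>\<sigma>. \<sigma> \<in> S \<Longrightarrow> pairwise coprime \<sigma>"
    and primepow: "\<And>\<sigma> q. \<sigma> \<in> S \<Longrightarrow> q \<in> \<sigma> \<Longrightarrow> primepow q"
    and exchange: "\<And>\<sigma> v. \<sigma> \<in> S \<Longrightarrow> v \<in> \<sigma> \<Longrightarrow> \<exists>w. w \<noteq> v \<and> insert w (\<sigma> - {v}) \<in> S"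
  shows "(\<exists>\<sigma>\<in>S. \<exists>i\<ge>1. (\<forall>l. 1 \<le> l \<longrightarrow> l < i \<longrightarrow> (\<exists>a\<ge>2. nth_prime l ^ a \<in> \<sigma>)) \<and>
            (\<forall>q\<in>\<sigma>. \<not> nth_prime i dvd q)) \<or>
    (\<exists>\<sigma>\<in>S. \<forall>l. 1 \<le> l \<longrightarrow> l \<le> t \<longrightarrow> (\<exists>a\<ge>2. nth_prime l ^ a \<in> \<sigma>))"
    (is "?gap \<or> ?powers t")
proof (induction t)
  case 0
  show ?case using S by auto
next
  case (Suc t)
  let ?p = "nth_prime (Suc t)"
  \<comment> \<open>The two harmless cases: the prime is not itself a member.\<close>
  have settle: "?gap \<or> ?powers (Suc t)"
    if \<sigma>: "\<sigma> \<in> S" "\<And>l. 1 \<le> l \<Longrightarrow> l \<le> t \<Longrightarrow> \<exists>a\<ge>2. nth_prime l ^ a \<in> \<sigma>" and p: "?p \<notin> \<sigma>" for \<sigma>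
  proof (cases "\<exists>q\<in>\<sigma>. ?p dvd q")
    case True
    then obtain q where q: "q \<in> \<sigma>" "?p dvd q" by blast
    obtain a where a: "a \<ge> 1" "q = ?p ^ a"
      using primepow_divisible_by_prime[OF primepow[OF \<sigma>(1) q(1)] nth_prime_prime q(2)] .
    have "a \<noteq> 1" using a q p by auto
    then have "a \<ge> 2" "?p ^ a \<in> \<sigma>" using a q by auto
    then have "?powers (Suc t)" using \<sigma> le_Suc_eq by metis
    then show ?thesis ..
  next
    case False
    then have ?gap using \<sigma> by (intro disjI1 bexI[of _ \<sigma>] exI[of _ "Suc t"]) auto
    then show ?thesis ..
  qed
  show ?case
  proof (cases ?gap)
    case False
    then obtain \<sigma> where \<sigma>: "\<sigma> \<in> S" "\<And>l. 1 \<le> l \<Longrightarrow> l \<le> t \<Longrightarrow> \<exists>a\<ge>2. nth_prime l ^ a \<in> \<sigma>"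
      using Suc.IH by blast
    show ?thesis
    proof (cases "?p \<in> \<sigma>")
      case True
      obtain w where w: "w \<noteq> ?p" "insert w (\<sigma> - {?p}) \<in> S"
        using exchange[OF \<sigma>(1) True] by blast
      have "\<exists>a\<ge>2. nth_prime l ^ a \<in> insert w (\<sigma> - {?p})" if l: "1 \<le> l" "l \<le> t" for l
      proof -
        obtain a where a: "a \<ge> 2" "nth_prime l ^ a \<in> \<sigma>" using \<sigma>(2)[OF l] by blast
        \<comment> \<open>A proper power is not prime, so it is not the vertex that was exchanged.\<close>
        have "nth_prime l ^ a \<noteq> ?p"
          using a(1) nth_prime_prime[of "Suc t"] prime_power_iff[of "nth_prime l" a] by auto
        then show ?thesis using a by auto
      qed
      then show ?thesis using settle[OF w(2)] w(1) by blast
    qed (use settle \<sigma> in blast)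
  qed blast
qed

text \<open>The search for a missing prime succeeds within the first \<open>M + 1\<close> primes, because powers of
  \<open>M + 1\<close> distinct primes do not fit into a set with \<open>M\<close> members.\<close>

lemma exchange_family_large_prod:
  assumes "S \<noteq> {}"
    and card: "\<And>\<sigma>. \<sigma> \<in> S \<Longrightarrow> finite \<sigma> \<and> card \<sigma> = M"
    and coprime: "\<And>\<sigma>. \<sigma> \<in> S \<Longrightarrow> pairwise coprime \<sigma>"
    and primepow: "\<And>\<sigma> q. \<sigma> \<in> S \<Longrightarrow> q \<in> \<sigma> \<Longrightarrow> primepow q"
    and exchange: "\<And>\<sigma> v. \<sigma> \<in> S \<Longrightarrow> v \<in> \<sigma> \<Longrightarrow> \<exists>w. w \<noteq> v \<and> insert w (\<sigma> - {v}) \<in> S"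
  shows "\<exists>\<sigma>\<in>S. (\<Prod>l=2..M+1. nth_prime l) \<le> \<Prod>\<sigma>"
proof -
  have no_powers: "\<not> (\<forall>l. 1 \<le> l \<longrightarrow> l \<le> M + 1 \<longrightarrow> (\<exists>a\<ge>2. nth_prime l ^ a \<in> \<sigma>))" if "\<sigma> \<in> S" for \<sigma>
  proof
    assume "\<forall>l. 1 \<le> l \<longrightarrow> l \<le> M + 1 \<longrightarrow> (\<exists>a\<ge>2. nth_prime l ^ a \<in> \<sigma>)"
    then obtain e where e: "\<And>l. 1 \<le> l \<Longrightarrow> l \<le> M + 1 \<Longrightarrow> e l \<ge> 2 \<and> nth_prime l ^ e l \<in> \<sigma>"
      by metis
    have "inj_on (\<lambda>l. nth_prime l ^ e l) {1..M+1}"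
    proof (rule inj_onI)
      fix l m assume lm: "l \<in> {1..M+1}" "m \<in> {1..M+1}" "nth_prime l ^ e l = nth_prime m ^ e m"
      then show "l = m" using e[of l] by (intro nth_prime_power_inj[OF _ _ _ lm(3)]) auto
    qed
    moreover have "(\<lambda>l. nth_prime l ^ e l) ` {1..M+1} \<subseteq> \<sigma>" using e by auto
    ultimately have "card {1..M+1} \<le> card \<sigma>"
      using card[OF that] by (intro card_inj_on_le) auto
    then show False using card[OF that] by simp
  qed
  have "\<exists>\<sigma>\<in>S. \<exists>i\<ge>1. (\<forall>l. 1 \<le> l \<longrightarrow> l < i \<longrightarrow> (\<exists>a\<ge>2. nth_prime l ^ a \<in> \<sigma>)) \<and>
      (\<forall>q\<in>\<sigma>. \<not> nth_prime i dvd q)"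
    using exchange_reaches_gap[OF assms(1) coprime primepow exchange, where t = "M + 1"]
  proof (rule disjE)
    assume "\<exists>\<sigma>\<in>S. \<forall>l. 1 \<le> l \<longrightarrow> l \<le> M + 1 \<longrightarrow> (\<exists>a\<ge>2. nth_prime l ^ a \<in> \<sigma>)"
    then show ?thesis using no_powers by (elim bexE) (rule notE)
  qed
  then obtain \<sigma> i where \<sigma>: "\<sigma> \<in> S" "i \<ge> 1"
      "\<forall>l. 1 \<le> l \<longrightarrow> l < i \<longrightarrow> (\<exists>a\<ge>2. nth_prime l ^ a \<in> \<sigma>)"
      "\<forall>q\<in>\<sigma>. \<not> nth_prime i dvd q"
    by (elim bexE exE conjE)
  have "(\<Prod>l=2..card \<sigma> + 1. nth_prime l) \<le> \<Prod>\<sigma>"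
  proof (rule prod_ge_if_proper_powers_then_gap)
    show "finite \<sigma>" "pairwise coprime \<sigma>" using card coprime \<sigma>(1) by auto
  qed (use primepow \<sigma> in auto)
  then show ?thesis using \<sigma>(1) card by metis
qed

section \<open>The homological degree\<close>

lemma coprime_complex_subset:
  assumes "\<sigma> \<in> coprime_complex n" "\<tau> \<subseteq> \<sigma>"
  shows "\<tau> \<in> coprime_complex n"
proof -
  have \<sigma>: "\<sigma> \<subseteq> {1..n}" "\<Prod>\<sigma> \<le> n" using assms(1) by (auto simp: coprime_complex_def)
  then have "finite \<sigma>" by (meson finite_atLeastAtMost finite_subset)
  then have "\<Prod>\<tau> \<le> \<Prod>\<sigma>"
    using assms(2) \<sigma>(1) by (intro dvd_imp_le prod_dvd_prod_subset prod_pos) auto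
  then show ?thesis
    using assms \<sigma> pairwise_subset[OF _ assms(2), of coprime] by (auto simp: coprime_complex_def)
qed

text \<open>The bound on the product of a simplex implies the bound on its vertices.\<close>

lemma coprime_complexI:
  assumes "finite \<sigma>" "pairwise coprime \<sigma>" "\<And>q. q \<in> \<sigma> \<Longrightarrow> primepow q" "\<Prod>\<sigma> \<le> n"
  shows "\<sigma> \<in> coprime_complex n"
proof -
  have pos: "q > 0" if "q \<in> \<sigma>" for q using assms(3)[OF that] by (rule primepow_gt_0_nat)
  have "q \<le> \<Prod>\<sigma>" if "q \<in> \<sigma>" for q
    using that assms(1) pos by (intro dvd_imp_le dvd_prodI[where f=id, simplified] prod_pos) auto
  then show ?thesis using assms pos by (force simp: coprime_complex_def)
qed

text \<open>Simplices of dimension \<open>k - 1\<close> may exist, so this is not just a bound on the dimension; they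
  do not suffice to form a cycle. The bound holds for all subcomplexes, because the exchange
  property of a cycle involves nothing but its support.\<close>

lemma trivial_homology_above:
  assumes bound: "n < (\<Prod>l=2..k+1. nth_prime l)"
    and K: "K \<subseteq> coprime_complex n" "\<And>\<sigma> \<tau>. \<sigma> \<in> K \<Longrightarrow> \<tau> \<subseteq> \<sigma> \<Longrightarrow> \<tau> \<in> K"
    and i: "i \<ge> int k - 1"
  shows "trivial_group (reduced_homology_group i K)"
proof (rule trivial_homology_if_no_cycles)
  fix c assume c: "c \<in> simplicial_cycles i K"
  define M where "M = nat (i + 1)"
  have M: "k \<le> M" using i by (simp add: M_def)
  have keys: "\<sigma> \<in> coprime_complex n" "finite \<sigma>" "card \<sigma> = M" if "\<sigma> \<in> Poly_Mapping.keys c" for \<sigma>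
    using that c K(1) by (auto simp: simplicial_cycles_iff simplices_of_dim_def M_def)
  show "c = 0"
  proof (rule ccontr)
    assume "c \<noteq> 0"
    then obtain \<sigma> where \<sigma>: "\<sigma> \<in> Poly_Mapping.keys c" "(\<Prod>l=2..M+1. nth_prime l) \<le> \<Prod>\<sigma>"
      using exchange_family_large_prod[of "Poly_Mapping.keys c" M] keys cycle_support_exchange[of c] c
      by (fastforce simp: coprime_complex_def simplicial_cycles_iff)
    have "(\<Prod>l=2..k+1. nth_prime l) dvd (\<Prod>l=2..M+1. nth_prime l)"
      using M by (intro prod_dvd_prod_subset) auto
    then have "(\<Prod>l=2..k+1. nth_prime l) \<le> (\<Prod>l=2..M+1. nth_prime l)"
      by (rule dvd_imp_le) (simp add: prod_pos nth_prime_pos)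
    then show False using \<sigma> keys(1)[OF \<sigma>(1)] bound by (simp add: coprime_complex_def)
  qed
qed (rule K(2))

text \<open>The sphere is the boundary of the simplex on \<open>p\<^sub>2, \<dots>, p\<^sub>k\<close> and a power \<open>2\<^sup>a\<close>.
  With \<open>R = p\<^sub>3 \<cdots> p\<^sub>k\<close> the exponent is chosen such that \<open>2\<^sup>a R \<le> n < 2\<^sup>a\<^sup>+\<^sup>1 R\<close>. Then the face
  omitting \<open>3\<close> has product \<open>2\<^sup>a R\<close>: it is a simplex, and another vertex would at least double
  the product. The faces omitting a larger prime have smaller products, and the face omitting
  \<open>2\<^sup>a\<close> has the product \<open>p\<^sub>2 \<cdots> p\<^sub>k\<close>, which is at most \<open>n\<close> by assumption.\<close>

lemma nontrivial_homology_at: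
  assumes k: "k \<ge> 2" and le: "(\<Prod>l=2..k. nth_prime l) \<le> n"
  shows "\<not> trivial_group (reduced_homology_group (int k - 2) (coprime_complex n))"
proof -
  define R where "R = (\<Prod>l=3..k. nth_prime l)"
  have R: "R > 0" by (simp add: R_def prod_pos nth_prime_pos)
  have prod_D: "(\<Prod>l=2..k. nth_prime l) = 3 * R"
    using k nth_prime_2 by (simp add: R_def prod.atLeast_Suc_atMost)
  have "3 * R \<le> n" using le prod_D by simp
  then have nR: "n div R \<ge> 3" using R by (simp add: less_eq_div_iff_mult_less_eq)
  then obtain a where a: "2 ^ a \<le> n div R" "n div R < 2 ^ (a + 1)"
    using ex_power_ivl1[of 2 "n div R"] by auto
  \<comment> \<open>\<open>2\<^sup>a\<close> has to be a vertex, so \<open>a = 0\<close> must be excluded; this uses \<open>n \<ge> 2 R\<close>.\<close>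
  have "a \<noteq> 0" using a(2) nR by (cases "a = 0") auto
  have aR: "2 ^ a * R \<le> n" "n < 2 * (2 ^ a * R)"
    using a R by (auto simp: less_eq_div_iff_mult_less_eq div_less_iff_less_mult mult_ac)
  define D where "D = nth_prime ` {2..k}"
  define T where "T = insert (2 ^ a) D"
  have inj: "inj_on nth_prime {2..k}" by (rule inj_onI) (use nth_prime_inj in auto)
  have D_ge: "p \<ge> 3" "prime p" if "p \<in> D" for p
    using that nth_prime_mono[of 2] nth_prime_2 nth_prime_prime by (force simp: D_def)+
  have odd: "coprime (2 ^ a) p" if "p \<in> D" for p
    using D_ge[OF that] by (simp add: coprime_left_2_iff_odd prime_odd_nat)
  have "2 ^ a \<notin> D" using odd[of "2 ^ a"] \<open>a \<noteq> 0\<close> by auto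
  have "finite D" by (simp add: D_def)
  have "card D = k - 1" using card_image[OF inj] by (simp add: D_def)
  then have T: "finite T" "int (card T) = int k - 2 + 2"
    using \<open>finite D\<close> \<open>2 ^ a \<notin> D\<close> k by (simp_all add: T_def)
  have prod_D': "\<Prod>D = 3 * R" unfolding D_def using prod_D by (simp add: prod.reindex[OF inj])
  then have prod_T: "\<Prod>T = 3 * (2 ^ a * R)" using \<open>finite D\<close> \<open>2 ^ a \<notin> D\<close> by (simp add: T_def)
  have "pairwise coprime D"
    using D_ge(2) by (auto simp: pairwise_def primes_coprime)
  then have coprime: "pairwise coprime T"
    using odd by (auto simp: T_def pairwise_insert coprime_commute)
  have primepow: "primepow q" if "q \<in> T" for q
    using that D_ge(2) \<open>a \<noteq> 0\<close> by (auto simp: T_def)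
  have three: "3 \<in> D" using k nth_prime_2 by (force simp: D_def)
  have prod_face: "\<Prod>T = v * \<Prod>(T - {v})" if "v \<in> T" for v
    using T(1) that by (rule prod.remove)
  show ?thesis
  proof (rule nontrivial_homology_if_maximal_face[OF T])
    show "3 \<in> T" using three by (simp add: T_def)
    fix v assume v: "v \<in> T"
    have "\<Prod>(T - {v}) \<le> n"
    proof (cases "v = 2 ^ a")
      case True
      then have "T - {v} = D" using \<open>2 ^ a \<notin> D\<close> by (auto simp: T_def)
      then show ?thesis using prod_D' \<open>3 * R \<le> n\<close> by simp
    next
      case False
      then have "3 \<le> v" using v D_ge(1) by (auto simp: T_def)
      then have "3 * \<Prod>(T - {v}) \<le> v * \<Prod>(T - {v})" by (rule mult_right_mono) simp
      also have "\<dots> = 3 * (2 ^ a * R)" using prod_face[OF v] prod_T by simp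
      finally show ?thesis using aR(1) by simp
    qed
    then show "T - {v} \<in> coprime_complex n"
      using T(1) pairwise_subset[OF coprime] primepow by (intro coprime_complexI) auto
  next
    fix w assume w: "w \<notin> T - {3}"
    show "insert w (T - {3}) \<notin> coprime_complex n"
    proof
      assume "insert w (T - {3}) \<in> coprime_complex n"
      then have "w > 1" "\<Prod>(insert w (T - {3})) \<le> n"
        using primepow_gt_Suc_0 by (auto simp: coprime_complex_def)
      moreover have "\<Prod>(insert w (T - {3})) = w * (2 ^ a * R)"
        using w T(1) prod_face[of 3] prod_T three by (simp add: T_def)
      moreover have "2 * (2 ^ a * R) \<le> w * (2 ^ a * R)"
        using \<open>w > 1\<close> by (intro mult_right_mono) auto
      ultimately show False using aR(2) by simp
    qed
  qed
qed

lemma ell_double_bounds: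
  assumes "n \<ge> 3"
  defines "k \<equiv> ell (2 * n)"
  shows "k \<ge> 2" "(\<Prod>l=2..k. nth_prime l) \<le> n" "n < (\<Prod>l=2..k+1. nth_prime l)"
proof -
  have ell: "(\<Prod>i=1..k. nth_prime i) \<le> 2 * n" "2 * n < (\<Prod>i=1..k+1. nth_prime i)"
    using theI'[OF ell_ex1[of "2 * n"]] assms(1) unfolding k_def ell_def by auto
  have split: "(\<Prod>i=1..m. nth_prime i) = 2 * (\<Prod>l=2..m. nth_prime l)" if "m \<ge> 1" for m
    using that nth_prime_1 by (simp add: prod.atLeast_Suc_atMost numeral_2_eq_2)
  show gt: "n < (\<Prod>l=2..k+1. nth_prime l)" using ell(2) split[of "k + 1"] by simp
  show k: "k \<ge> 2"
  proof (rule ccontr)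
    assume "\<not> k \<ge> 2"
    then have "k = 0 \<or> k = 1" by auto
    then have "(\<Prod>l=2..k+1. nth_prime l) \<le> 3"
      using nth_prime_2 by (auto simp: numeral_2_eq_2)
    then show False using gt assms(1) by simp
  qed
  show "(\<Prod>l=2..k. nth_prime l) \<le> n" using ell(1) split[of k] k by simp
qed

theorem lemma6p4:
  fixes n :: nat
  assumes "n \<ge> 3"
  shows "has_homological_degree (coprime_complex n) (v_index n) \<and>
    ((\<exists>U. U \<noteq> {} \<and> U \<subseteq> {1..n} \<and>
          has_homological_degree (induced_subcomplex (coprime_complex n) U) (v_index n)) \<and>
     (\<forall>U d. U \<noteq> {} \<and> U \<subseteq> {1..n} \<and>
          has_homological_degree (induced_subcomplex (coprime_complex n) U) d \<longrightarrow> d \<le> v_index n))"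
proof -
  define k where "k = ell (2 * n)"
  note k = ell_double_bounds[OF assms, folded k_def]
  have v: "v_index n = int k - 2" by (simp add: v_index_def k_def)
  have above: "i \<le> v_index n"
    if "\<not> trivial_group (reduced_homology_group i (induced_subcomplex (coprime_complex n) U))" for i U
  proof (rule ccontr)
    assume "\<not> i \<le> v_index n"
    then have "trivial_group (reduced_homology_group i (induced_subcomplex (coprime_complex n) U))"
      using v coprime_complex_subset
      by (intro trivial_homology_above[OF k(3)]) (auto simp: induced_subcomplex_def)
    with that show False ..
  qed
  have full: "induced_subcomplex (coprime_complex n) {1..n} = coprime_complex n"
    by (auto simp: induced_subcomplex_def coprime_complex_def)
  have "has_homological_degree (coprime_complex n) (v_index n)"
    using nontrivial_homology_at[OF k(1,2)] above[of _ "{1..n}"]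
    unfolding has_homological_degree_def v full by blast
  moreover have "{1..n} \<noteq> {}" using assms by auto
  ultimately show ?thesis
    using above full unfolding has_homological_degree_def by (metis order_refl)
qed

end
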